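(* Let $(X:Y:Z:W)\in\mathbf{P}^3(\mathbf{Q})$ be a rational point with $X^4+Y^4=Z^4+W^4$ and $ZW\neq 0$, and define $$a=\frac{X^4-W^4}{Z^2W^2},\qquad b=-\frac{W^2}{Z^2},\qquad c=\frac{Y^4-W^4}{Z^2W^2},\qquad d=\frac{Z^2}{W^2}.$$ Then $$ab+1=\left(\frac{Y}{Z}\right)^4,\qquad ac+1=\left(\frac{XY}{ZW}\right)^4,\qquad ad+1=\left(\frac{X}{W}\right)^4,$$ $$bc+1=\left(\frac{X}{Z}\right)^4,\qquad bd+1=0,\qquad cd+1=\left(\frac{Y}{W}\right)^4.$$ Moreover, the four numbers $a,b,c,d$ are pairwise distinct and nonzero if and only if $$XYZW\,(X^2-Y^2)(X^2-W^2)(Y^2-W^2)\neq 0.$$ In that case $\{a,b,c,d\}$ is a quartic rational Diophantine quadruple.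
   Context: A quartic rational Diophantine quadruple is a set of four pairwise distinct nonzero rational numbers $\{a_1,a_2,a_3,a_4\}$ such that for every $1\le i<j\le 4$ the number $a_ia_j+1$ is a fourth power in $\mathbf{Q}$ (where $0=0^4$ counts as a fourth power). The surface $X^4+Y^4=Z^4+W^4$ in $\mathbf{P}^3$ is called the Euler surface. *)

theory Defs
  imports Complex_Main
begin

definition proj3_rel :: "((rat \<times> rat \<times> rat \<times> rat) \<times> (rat \<times> rat \<times> rat \<times> rat)) set" where
  "proj3_rel = {((x, y, z, w), (x', y', z', w')).
     (x, y, z, w) \<noteq> (0, 0, 0, 0) \<and> (x', y', z', w') \<noteq> (0, 0, 0, 0) \<and>
     (\<exists>t. t \<noteq> 0 \<and> x' = t * x \<and> y' = t * y \<and> z' = t * z \<and> w' = t * w)}"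

text \<open>A rational point is the set of all its homogeneous coordinate vectors; the coordinate vector
  \<open>(X, Y, Z, W)\<close> belongs to \<open>P\<close> iff \<open>P = (X : Y : Z : W)\<close>.\<close>

definition proj3_points :: "(rat \<times> rat \<times> rat \<times> rat) set set" where
  "proj3_points = (UNIV - {(0, 0, 0, 0)}) // proj3_rel"

definition euler_surface_points :: "(rat \<times> rat \<times> rat \<times> rat) set set" where
  "euler_surface_points =
     {P \<in> proj3_points. \<forall>(x, y, z, w) \<in> P. x ^ 4 + y ^ 4 = z ^ 4 + w ^ 4}"

lemma equiv_proj3_rel: "equiv (UNIV - {(0, 0, 0, 0)}) proj3_rel"
proof (rule equivI)
  show "proj3_rel \<subseteq> (UNIV - {(0, 0, 0, 0)}) \<times> (UNIV - {(0, 0, 0, 0)})"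
    unfolding proj3_rel_def by clarsimp
  show "refl_on (UNIV - {(0, 0, 0, 0)}) proj3_rel"
  proof (rule refl_onI)
    fix v :: "rat \<times> rat \<times> rat \<times> rat"
    assume v: "v \<in> UNIV - {(0, 0, 0, 0)}"
    obtain x y z w where e: "v = (x, y, z, w)"
      by (cases v)
    have "(1 :: rat) \<noteq> 0 \<and> x = 1 * x \<and> y = 1 * y \<and> z = 1 * z \<and> w = 1 * w"
      by simp
    then have "\<exists>t. t \<noteq> 0 \<and> x = t * x \<and> y = t * y \<and> z = t * z \<and> w = t * w"
      by (rule exI)
    with v show "(v, v) \<in> proj3_rel"
      unfolding e proj3_rel_def mem_Collect_eq prod.case by blast
  qed
  show "sym proj3_rel"
  proof (rule symI, clarify)
    fix x y z w x' y' z' w' :: rat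
    assume "((x, y, z, w), (x', y', z', w')) \<in> proj3_rel"
    then obtain t where nz: "(x, y, z, w) \<noteq> (0, 0, 0, 0)" "(x', y', z', w') \<noteq> (0, 0, 0, 0)"
      and t: "t \<noteq> 0" "x' = t * x" "y' = t * y" "z' = t * z" "w' = t * w"
      unfolding proj3_rel_def mem_Collect_eq prod.case by blast
    from t have "inverse t \<noteq> 0 \<and> x = inverse t * x' \<and> y = inverse t * y'
        \<and> z = inverse t * z' \<and> w = inverse t * w'"
      by simp
    then have "\<exists>t. t \<noteq> 0 \<and> x = t * x' \<and> y = t * y' \<and> z = t * z' \<and> w = t * w'"
      by (rule exI)
    with nz show "((x', y', z', w'), (x, y, z, w)) \<in> proj3_rel"
      unfolding proj3_rel_def mem_Collect_eq prod.case by (intro conjI)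
  qed
  show "trans proj3_rel"
  proof (rule transI, clarify)
    fix x y z w x' y' z' w' x'' y'' z'' w'' :: rat
    assume 1: "((x, y, z, w), (x', y', z', w')) \<in> proj3_rel"
      and 2: "((x', y', z', w'), (x'', y'', z'', w'')) \<in> proj3_rel"
    from 1 obtain s where nz1: "(x, y, z, w) \<noteq> (0, 0, 0, 0)"
      and s: "s \<noteq> 0" "x' = s * x" "y' = s * y" "z' = s * z" "w' = s * w"
      unfolding proj3_rel_def mem_Collect_eq prod.case by blast
    from 2 obtain t where nz2: "(x'', y'', z'', w'') \<noteq> (0, 0, 0, 0)"
      and t: "t \<noteq> 0" "x'' = t * x'" "y'' = t * y'" "z'' = t * z'" "w'' = t * w'"
      unfolding proj3_rel_def mem_Collect_eq prod.case by blast
    from s t have "t * s \<noteq> 0 \<and> x'' = (t * s) * x \<and> y'' = (t * s) * y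
        \<and> z'' = (t * s) * z \<and> w'' = (t * s) * w"
      by (simp add: mult.assoc)
    then have "\<exists>t. t \<noteq> 0 \<and> x'' = t * x \<and> y'' = t * y \<and> z'' = t * z \<and> w'' = t * w"
      by (rule exI)
    with nz1 nz2 show "((x, y, z, w), (x'', y'', z'', w'')) \<in> proj3_rel"
      unfolding proj3_rel_def mem_Collect_eq prod.case by (intro conjI)
  qed
qed

definition quartic_rational_diophantine_quadruple :: "rat set \<Rightarrow> bool" where
  "quartic_rational_diophantine_quadruple S \<longleftrightarrow>
     card S = 4 \<and> 0 \<notin> S \<and> (\<forall>x\<in>S. \<forall>y\<in>S. x \<noteq> y \<longrightarrow> (\<exists>r::rat. x * y + 1 = r ^ 4))"

end

theory Submission
  imports Defs
begin

text \<open>Clearing denominators, \<open>a * d + 1\<close> and \<open>c * d + 1\<close> are visibly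
  fourth powers, and \<open>b * d = - 1\<close>. For \<open>a * b + 1\<close>,
  \<open>b * c + 1\<close> and \<open>a * c + 1\<close> the surface equation turns the numerator
  into \<open>Y ^ 4\<close>, \<open>X ^ 4\<close> and \<open>X ^ 4 * Y ^ 4\<close>. These formulas
  also decide degeneracy: since \<open>b * d = - 1\<close>, a number x equals \<open>b\<close> iff
  \<open>x * d + 1 = 0\<close> and equals \<open>d\<close> iff \<open>b * x + 1 = 0\<close>, so
  \<open>a\<close> or \<open>c\<close> meets \<open>b\<close> or \<open>d\<close> only when X or Y
  vanishes. The remaining coincidences \<open>a = 0\<close>, \<open>c = 0\<close>,
  \<open>a = c\<close> equate two fourth powers, hence two squares by
  \<open>power4_eq_iff_power2_eq\<close>.\<close>

text \<open>Squares are nonnegative, and squaring is injective on nonnegative elements.\<close>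

lemma power4_eq_iff_power2_eq:
  fixes x y :: "'a::linordered_idom"
  shows "x ^ 4 = y ^ 4 \<longleftrightarrow> x ^ 2 = y ^ 2"
  using power2_eq_iff_nonneg[of "x ^ 2" "y ^ 2"] by (simp flip: power_mult)

text \<open>The definition ranges over ordered pairs of a set; commutativity leaves the six products
  of a list without repetition.\<close>

lemma quartic_rational_diophantine_quadrupleI:
  fixes a b c d :: rat
  assumes "distinct [a, b, c, d]" "a \<noteq> 0" "b \<noteq> 0" "c \<noteq> 0" "d \<noteq> 0"
    and "a * b + 1 = p ^ 4" "a * c + 1 = q ^ 4" "a * d + 1 = r ^ 4"
    and "b * c + 1 = s ^ 4" "b * d + 1 = t ^ 4" "c * d + 1 = u ^ 4"
  shows "quartic_rational_diophantine_quadruple {a, b, c, d}"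
proof -
  have "\<exists>v. x * y + 1 = v ^ 4" if "x \<in> {a, b, c, d}" "y \<in> {a, b, c, d}" "x \<noteq> y" for x y
    using that assms(6-11) by (elim insertE emptyE) (simp_all add: mult.commute, blast+)
  moreover have "card {a, b, c, d} = 4"
    using assms(1) by simp
  ultimately show ?thesis
    using assms(2-5) by (simp add: quartic_rational_diophantine_quadruple_def)
qed

theorem proposition1p3:
  fixes P :: "(rat \<times> rat \<times> rat \<times> rat) set"
    and X Y Z W a b c d :: rat
  assumes "P \<in> euler_surface_points"
    and "(X, Y, Z, W) \<in> P"
    and "Z * W \<noteq> 0"
    and "a = (X ^ 4 - W ^ 4) / (Z ^ 2 * W ^ 2)"
    and "b = - (W ^ 2 / Z ^ 2)"
    and "c = (Y ^ 4 - W ^ 4) / (Z ^ 2 * W ^ 2)"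
    and "d = Z ^ 2 / W ^ 2"
  shows "(a * b + 1 = (Y / Z) ^ 4 \<and>
          a * c + 1 = ((X * Y) / (Z * W)) ^ 4 \<and>
          a * d + 1 = (X / W) ^ 4 \<and>
          b * c + 1 = (X / Z) ^ 4 \<and>
          b * d + 1 = 0 \<and>
          c * d + 1 = (Y / W) ^ 4) \<and>
         (distinct [a, b, c, d] \<and> a \<noteq> 0 \<and> b \<noteq> 0 \<and> c \<noteq> 0 \<and> d \<noteq> 0 \<longleftrightarrow>
            X * Y * Z * W * (X ^ 2 - Y ^ 2) * (X ^ 2 - W ^ 2) * (Y ^ 2 - W ^ 2) \<noteq> 0) \<and>
         (X * Y * Z * W * (X ^ 2 - Y ^ 2) * (X ^ 2 - W ^ 2) * (Y ^ 2 - W ^ 2) \<noteq> 0 \<longrightarrow>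
            quartic_rational_diophantine_quadruple {a, b, c, d})"
proof -
  have euler: "X ^ 4 + Y ^ 4 = Z ^ 4 + W ^ 4"
    using assms(1,2) by (auto simp: euler_surface_points_def)
  have nz: "Z \<noteq> 0" "W \<noteq> 0"
    using assms(3) by auto
  note defs = assms(4-7)
  have ab: "a * b + 1 = (Y / Z) ^ 4"
  proof -
    \<comment> \<open>The numerator keeps \<open>Z ^ 4 + W ^ 4\<close> together, so that rewriting
      it to \<open>X ^ 4 + Y ^ 4\<close> leaves \<open>Y ^ 4\<close>.\<close>
    have "a * b + 1 = (Z ^ 4 + W ^ 4 - X ^ 4) / Z ^ 4"
      using nz unfolding defs by (simp add: field_simps power4_eq_xxxx power2_eq_square)
    then show ?thesis
      by (simp add: power_divide flip: euler)
  qed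
  have bc: "b * c + 1 = (X / Z) ^ 4"
  proof -
    have "b * c + 1 = (Z ^ 4 + W ^ 4 - Y ^ 4) / Z ^ 4"
      using nz unfolding defs by (simp add: field_simps power4_eq_xxxx power2_eq_square)
    then show ?thesis
      by (simp add: power_divide flip: euler)
  qed
  have ac: "a * c + 1 = ((X * Y) / (Z * W)) ^ 4"
  proof -
    have "a * c + 1 = ((X ^ 4 - W ^ 4) * (Y ^ 4 - W ^ 4) + Z ^ 4 * W ^ 4) / (Z ^ 4 * W ^ 4)"
      using nz unfolding defs by (simp add: divide_simps power4_eq_xxxx power2_eq_square)
    \<comment> \<open>The left side is
      \<open>X ^ 4 * Y ^ 4 - W ^ 4 * (X ^ 4 + Y ^ 4 - Z ^ 4 - W ^ 4)\<close>.\<close>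
    also have "(X ^ 4 - W ^ 4) * (Y ^ 4 - W ^ 4) + Z ^ 4 * W ^ 4 = X ^ 4 * Y ^ 4"
      using euler by algebra
    finally show ?thesis
      by (simp add: power_divide power_mult_distrib)
  qed
  have ad: "a * d + 1 = (X / W) ^ 4"
    using nz unfolding defs by (simp add: field_simps power4_eq_xxxx power2_eq_square)
  have bd: "b * d + 1 = 0"
    using nz unfolding defs by simp
  have cd: "c * d + 1 = (Y / W) ^ 4"
    using nz unfolding defs by (simp add: field_simps power4_eq_xxxx power2_eq_square)
  \<comment> \<open>The opposite signs settle \<open>b \<noteq> 0\<close>,
    \<open>d \<noteq> 0\<close> and \<open>b \<noteq> d\<close> at once.\<close>
  have b0: "b < 0" and d0: "0 < d"
    using nz unfolding defs by simp_all
  have a_eq_0: "a = 0 \<longleftrightarrow> X ^ 2 = W ^ 2" and c_eq_0: "c = 0 \<longleftrightarrow> Y ^ 2 = W ^ 2"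
    using nz unfolding defs by (simp_all add: power4_eq_iff_power2_eq)
  have a_eq_c: "a = c \<longleftrightarrow> X ^ 2 = Y ^ 2"
    using nz unfolding defs by (simp add: power4_eq_iff_power2_eq)
  \<comment> \<open>Through \<open>b * d = - 1\<close>, coincidences with \<open>b\<close> or \<open>d\<close> become vanishing of the fourth powers above.\<close>
  have eq_b: "x = b \<longleftrightarrow> x * d + 1 = 0" for x
  proof -
    have "x * d + 1 = (x - b) * d"
      using bd by (simp add: algebra_simps)
    then show ?thesis
      using d0 by simp
  qed
  have eq_d: "x = d \<longleftrightarrow> b * x + 1 = 0" for x
  proof -
    have "b * x + 1 = b * (x - d)"
      using bd by (simp add: algebra_simps)
    then show ?thesis
      using b0 by simp
  qed
  have a_eq_b: "a = b \<longleftrightarrow> X = 0" and c_eq_b: "c = b \<longleftrightarrow> Y = 0"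
    using nz by (simp_all add: eq_b ad cd)
  have a_eq_d: "a = d \<longleftrightarrow> Y = 0" and c_eq_d: "c = d \<longleftrightarrow> X = 0"
    using nz ab by (simp_all add: eq_d bc mult.commute)
  have iff: "distinct [a, b, c, d] \<and> a \<noteq> 0 \<and> b \<noteq> 0 \<and> c \<noteq> 0 \<and> d \<noteq> 0 \<longleftrightarrow>
      X * Y * Z * W * (X ^ 2 - Y ^ 2) * (X ^ 2 - W ^ 2) * (Y ^ 2 - W ^ 2) \<noteq> 0"
    using b0 d0 nz a_eq_0 c_eq_0 a_eq_b a_eq_c a_eq_d c_eq_b c_eq_d by auto
  have "quartic_rational_diophantine_quadruple {a, b, c, d}"
    if "X * Y * Z * W * (X ^ 2 - Y ^ 2) * (X ^ 2 - W ^ 2) * (Y ^ 2 - W ^ 2) \<noteq> 0"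
  proof -
    \<comment> \<open>Zero counts as a fourth power, which covers the pair \<open>b\<close>,
      \<open>d\<close>.\<close>
    have "b * d + 1 = 0 ^ 4"
      using bd by simp
    with that show ?thesis
      using quartic_rational_diophantine_quadrupleI[OF _ _ _ _ _ ab ac ad bc _ cd]
      unfolding iff[symmetric] by blast
  qed
  with ab ac ad bc bd cd iff show ?thesis
    by blast
qed

end
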